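(* Let $f$ be smooth and suppose that, for a fixed value of $v$, the Ricci scalar $R(v,r)$ of the exterior satisfies $$f_{,R}(R(v,r))=A(v)\,r+B(v)$$ with $f_{,R}(R(v,r))>0$, and that the solution extends to arbitrarily large $r$ (i.e. this holds for all $r\ge r_1$, some $r_1>0$, with $R(v,\cdot)$ continuous). Then either $A(v)=0$ with $B(v)>0$, or $A(v)>0$. In the nontrivial case $A(v)\neq0$, $$f_{,R}(R(v,r))\to+\infty\qquad(r\to\infty).$$ Assume further, in the case $A(v)\neq 0$, that the inverse branch $\Phi=(f_{,R})^{-1}$ can be continued along the solution for sufficiently large $f_{,R}$, so that $R(v,r)=\Phi(f_{,R}(R(v,r)))$ for large $r$. Then: 1. If $f_{,R}$ is bounded from above along the corresponding inverse branch $\Phi$ (equivalently, on the curvature range attained by the solution), then the relation $f_{,R}(R(v,r))=A(v)r+B(v)$ cannot hold for arbitrarily large $r$, and therefore no global extension to arbitrarily large $r$ exists. 2. If (along the branch) $f_{,R}(R)\to+\infty$ only when $R\to\infty$, then $R(v,r)\to\infty$ as $r\to\infty$. 3. A finite asymptotic limit $R(v,r)\to R_*$, $R_*<\infty$, as $r\to\infty$ is possible only if (along the branch) $f_{,R}(R)\to+\infty$ as $R\to R_*$. In particular, if $f_{,R}$ remains finite at all finite curvature, then the branch $A(v)\neq0$ cannot admit a global extension (to arbitrarily large $r$) with finite asymptotic curvature.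
   Context: $f_{,R}=df/dR$. Here $R(v,r)$ is the Ricci scalar of a generalized Vaidya metric $ds^2=-(1-2M(v,r)/r)dv^2+2\,dv\,dr+r^2d\Omega^2$, and the linear relation is the one forced by the metric $f(R)$ field equations with generalized Vaidya matter; $A(v),B(v)$ are real functions of $v$. "Inverse branch" means: there is an interval $O$ of curvatures on which $f_{,R}$ is continuous and injective, containing $R(v,r)$ for all large $r$, and $\Phi$ is the inverse of $f_{,R}|_O$; limits "along the branch" are taken with $R\in O$. "$f_{,R}(R)\to+\infty$ only when $R\to\infty$" means that for any sequence $R_n\in O$ with $f_{,R}(R_n)\to+\infty$ one has $R_n\to\infty$. "$f_{,R}$ remains finite at all finite curvature" means that for every finite $R_*$, $f_{,R}(R)$ stays bounded as $R\to R_*$. "Finite asymptotic curvature" means $R(v,r)$ has a finite limit as $r\to\infty$. *)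

theory Defs
  imports "HOL-Analysis.Analysis"
begin

subsection \<open>Scalar curvature of a metric in coordinates\<close>

text \<open>Everything is computed from the matrix of metric components by coordinate partial
  derivatives, with the sign convention that gives round spheres positive curvature.\<close>

definition partial :: "'n::finite \<Rightarrow> (real^'n \<Rightarrow> real) \<Rightarrow> real^'n \<Rightarrow> real" where
  "partial i F x = deriv (\<lambda>t. F (x + t *\<^sub>R axis i 1)) 0"

definition christoffel ::
    "(real^'n \<Rightarrow> real^'n^'n) \<Rightarrow> 'n::finite \<Rightarrow> 'n \<Rightarrow> 'n \<Rightarrow> real^'n \<Rightarrow> real" where
  "christoffel g k i j x =
     (\<Sum>l\<in>UNIV. matrix_inv (g x) $ k $ l *
        (partial i (\<lambda>y. g y $ l $ j) x + partial j (\<lambda>y. g y $ l $ i) x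
         - partial l (\<lambda>y. g y $ i $ j) x)) / 2"

definition ricci ::
    "(real^'n \<Rightarrow> real^'n^'n) \<Rightarrow> 'n::finite \<Rightarrow> 'n \<Rightarrow> real^'n \<Rightarrow> real" where
  "ricci g i j x =
     (\<Sum>k\<in>UNIV. partial k (christoffel g k i j) x - partial j (christoffel g k i k) x
        + (\<Sum>l\<in>UNIV. christoffel g k k l x * christoffel g l i j x
                    - christoffel g k j l x * christoffel g l i k x))"

definition ricci_scalar :: "(real^'n \<Rightarrow> real^'n^'n) \<Rightarrow> real^'n::finite \<Rightarrow> real" where
  "ricci_scalar g x = (\<Sum>i\<in>UNIV. \<Sum>j\<in>UNIV. matrix_inv (g x) $ i $ j * ricci g i j x)"

subsection \<open>The generalized Vaidya metric\<close>

text \<open>Coordinates are ordered as $(v, r, \theta, \phi)$.\<close>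

definition vaidya_metric :: "(real \<Rightarrow> real \<Rightarrow> real) \<Rightarrow> real^4 \<Rightarrow> real^4^4" where
  "vaidya_metric M x =
     (let v = x$1; r = x$2; \<theta> = x$3 in
      vector [vector [- (1 - 2 * M v r / r), 1, 0,   0],
              vector [1,                     0, 0,   0],
              vector [0,                     0, r^2, 0],
              vector [0,                     0, 0,   r^2 * (sin \<theta>)^2]])"

text \<open>The scalar curvature does not depend on the angles
  (\<open>ricci_scalar_vaidya_metric\<close> below), so it is evaluated on the equator; the poles have to be
  avoided because the coordinates degenerate there.\<close>

definition vaidya_curvature :: "(real \<Rightarrow> real \<Rightarrow> real) \<Rightarrow> real \<Rightarrow> real \<Rightarrow> real" where
  "vaidya_curvature M v r = ricci_scalar (vaidya_metric M) (vector [v, r, pi / 2, 0])"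

lemma vec4:
  "(vector [a,b,c,d] :: 'a::zero^4) $ 1 = a"
  "(vector [a,b,c,d] :: 'a::zero^4) $ 2 = b"
  "(vector [a,b,c,d] :: 'a::zero^4) $ 3 = c"
  "(vector [a,b,c,d] :: 'a::zero^4) $ 4 = d"
  unfolding vector_def by auto

lemma matrix_inv_eqI:
  fixes A :: "real^'n^'n"
  assumes "A ** B = mat 1" "B ** A = mat 1"
  shows "matrix_inv A = B"
  unfolding matrix_inv_def
proof (rule some_equality)
  fix C assume C: "A ** C = mat 1 \<and> C ** A = mat 1"
  have "C = C ** (A ** B)" using assms by simp
  also have "\<dots> = B" using C by (simp add: matrix_mul_assoc)
  finally show "C = B" .
qed (use assms in simp)

lemma vaidya_inv:
  assumes "x$2 > 0" "0 < x$3" "x$3 < pi"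
  shows "matrix_inv (vaidya_metric M x) =
     vector [vector [0, 1, 0, 0],
             vector [1, 1 - 2 * M (x$1) (x$2) / x$2, 0, 0],
             vector [0, 0, 1 / (x$2)^2, 0],
             vector [0, 0, 0, 1 / ((x$2)^2 * (sin (x$3))^2)]]"
    (is "_ = ?B")
proof -
  have s: "sin (x$3) > 0" using assms by (simp add: sin_gt_zero)
  have "vaidya_metric M x ** ?B = mat 1" "?B ** vaidya_metric M x = mat 1"
    unfolding vaidya_metric_def Let_def
    using s assms
    by (simp_all add: matrix_matrix_mult_def mat_def vec_eq_iff forall_4 sum_4 vec4)
  then show ?thesis by (rule matrix_inv_eqI)
qed

lemma partial_eqI:
  assumes "((\<lambda>t. F (x + t *\<^sub>R axis i 1)) has_real_derivative D) (at 0)"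
  shows "partial i F x = D"
  unfolding partial_def using assms by (rule DERIV_imp_deriv)

lemma partial_cong_open:
  assumes "open U" "x \<in> U" "\<And>y. y \<in> U \<Longrightarrow> F y = G y"
  shows "partial i F x = partial i G x"
proof -
  have "open ((\<lambda>t::real. x + t *\<^sub>R axis i 1) -` U)"
    by (intro open_vimage assms continuous_intros)
  moreover have "0 \<in> (\<lambda>t::real. x + t *\<^sub>R axis i 1) -` U" using assms by simp
  ultimately have "eventually (\<lambda>t::real. t \<in> (\<lambda>t. x + t *\<^sub>R axis i 1) -` U) (nhds 0)"
    by (rule eventually_nhds_in_open)
  then have "eventually (\<lambda>t. F (x + t *\<^sub>R axis i 1) = G (x + t *\<^sub>R axis i 1)) (nhds 0)"
    by eventually_elim (use assms in auto)
  then show ?thesis unfolding partial_def by (rule deriv_cong_ev) simp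
qed

definition chart :: "(real^4) set" where "chart = {x. 0 < x$2 \<and> 0 < x$3 \<and> x$3 < pi}"

lemma open_chart: "open chart"
  unfolding chart_def
  by (intro open_Collect_conj open_Collect_less continuous_intros)

lemma axis4: "(axis 1 1 :: real^4)$1 = 1" "(axis 1 1 :: real^4)$2 = 0" "(axis 1 1 :: real^4)$3 = 0" "(axis 1 1 :: real^4)$4 = 0"
 "(axis 2 1 :: real^4)$1 = 0" "(axis 2 1 :: real^4)$2 = 1" "(axis 2 1 :: real^4)$3 = 0" "(axis 2 1 :: real^4)$4 = 0"
 "(axis 3 1 :: real^4)$1 = 0" "(axis 3 1 :: real^4)$2 = 0" "(axis 3 1 :: real^4)$3 = 1" "(axis 3 1 :: real^4)$4 = 0"
 "(axis 4 1 :: real^4)$1 = 0" "(axis 4 1 :: real^4)$2 = 0" "(axis 4 1 :: real^4)$3 = 0" "(axis 4 1 :: real^4)$4 = 1"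
  by (auto simp: axis_def)

lemma partial_const [simp]: "partial i (\<lambda>y. c) x = 0"
  by (rule partial_eqI) auto

text \<open>Auxiliary closed forms: \<open>vh\<close> is the $vv$-component of the metric and
  \<open>vc M x k i j\<close> the Christoffel symbol $\Gamma^k_{ij}$.\<close>

definition vh where "vh M x = - (1 - 2 * M (x$1) (x$2) / (x$2))" for x :: "real^4"
definition vc :: "(real \<Rightarrow> real \<Rightarrow> real) \<Rightarrow> real^4 \<Rightarrow> 4 \<Rightarrow> 4 \<Rightarrow> 4 \<Rightarrow> real" where
 "vc M x k i j = (let p1 = partial 1 (vh M) x; p2 = partial 2 (vh M) x; h = vh M x;
    r = x$2; s = sin (x$3); c = cos (x$3) in
   if k = 1 then (if i = 1 \<and> j = 1 then - p2/2 else if i = 3 \<and> j = 3 then - r else if i = 4 \<and> j = 4 then - (r * s^2) else 0)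
   else if k = 2 then (if i = 1 \<and> j = 1 then p1/2 + h*p2/2 else if (i=1\<and>j=2) \<or> (i=2\<and>j=1) then p2/2
      else if i = 3 \<and> j = 3 then h*r else if i = 4 \<and> j = 4 then h*r* s^2 else 0)
   else if k = 3 then (if (i=2\<and>j=3) \<or> (i=3\<and>j=2) then 1/r else if i=4\<and>j=4 then - (s * c) else 0)
   else (if (i=2\<and>j=4) \<or> (i=4\<and>j=2) then 1/r else if (i=3\<and>j=4) \<or> (i=4\<and>j=3) then c/s else 0))"

lemma vm_comp: 
  "vaidya_metric M y $ 1 $ 1 = vh M y" 
  "vaidya_metric M y $ 1 $ 2 = 1" "vaidya_metric M y $ 1 $ 3 = 0" "vaidya_metric M y $ 1 $ 4 = 0"
  "vaidya_metric M y $ 2 $ 1 = 1" "vaidya_metric M y $ 2 $ 2 = 0" "vaidya_metric M y $ 2 $ 3 = 0" "vaidya_metric M y $ 2 $ 4 = 0"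
  "vaidya_metric M y $ 3 $ 1 = 0" "vaidya_metric M y $ 3 $ 2 = 0" "vaidya_metric M y $ 3 $ 3 = (y$2)^2" "vaidya_metric M y $ 3 $ 4 = 0"
  "vaidya_metric M y $ 4 $ 1 = 0" "vaidya_metric M y $ 4 $ 2 = 0" "vaidya_metric M y $ 4 $ 3 = 0" "vaidya_metric M y $ 4 $ 4 = (y$2)^2 * (sin (y$3))^2"
  unfolding vaidya_metric_def vh_def Let_def by (simp_all add: vec4)

lemma partial_vh34: "partial 3 (vh M) x = 0" "partial 4 (vh M) x = 0"
  unfolding partial_def vh_def by (simp_all add: axis4)

lemma partial_r2: "partial 1 (\<lambda>y. (y$2)^2) x = 0" "partial 2 (\<lambda>y. (y$2)^2) x = 2 * x$2"
   "partial 3 (\<lambda>y. (y$2)^2) x = 0" "partial 4 (\<lambda>y. (y$2)^2) x = 0" for x :: "real^4"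
  by (rule partial_eqI, auto simp: axis4 intro!: derivative_eq_intros)+

lemma partial_r2s: "partial 1 (\<lambda>y. (y$2)^2*(sin (y$3))^2) x = 0" 
   "partial 2 (\<lambda>y. (y$2)^2*(sin (y$3))^2) x = 2 * x$2 * (sin (x$3))^2"
   "partial 3 (\<lambda>y. (y$2)^2*(sin (y$3))^2) x = (x$2)^2 * (2 * sin (x$3) * cos (x$3))" 
   "partial 4 (\<lambda>y. (y$2)^2*(sin (y$3))^2) x = 0" for x :: "real^4"
  by (rule partial_eqI, auto simp: axis4 intro!: derivative_eq_intros)+

lemma chr_all:
  assumes "x \<in> chart"
  shows "\<forall>k i j. christoffel (vaidya_metric M) k i j x = vc M x k i j"
proof -
  have s: "sin (x$3) > 0" "x$2 > 0" using assms by (auto simp: chart_def sin_gt_zero)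
  have inv: "matrix_inv (vaidya_metric M x) =
     vector [vector [0, 1, 0, 0],
             vector [1, - vh M x, 0, 0],
             vector [0, 0, 1 / (x$2)^2, 0],
             vector [0, 0, 0, 1 / ((x$2)^2 * (sin (x$3))^2)]]"
    using vaidya_inv[of x M] assms by (simp add: chart_def vh_def)
  show ?thesis
    unfolding forall_4 christoffel_def inv sum_4 vc_def Let_def vec4 vm_comp 
      partial_vh34 partial_r2 partial_r2s partial_const
    apply (intro conjI)
    using s apply simp_all
    apply (simp_all add: field_simps power2_eq_square)
    done
qed


lemma shift0:
  assumes "(f has_real_derivative D) (at a)"
  shows "((\<lambda>t. f (a + t)) has_real_derivative D) (at 0)"
  using assms DERIV_shift[of f D 0 a] by (simp add: add.commute)

lemma ricci_scalar_vaidya_metric: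
  assumes "r > 0" "0 < \<theta>" "\<theta> < pi"
    and M1: "\<And>s. s > 0 \<Longrightarrow> (M v has_real_derivative M1 s) (at s)"
    and M2: "(M1 has_real_derivative M2) (at r)"
  shows "ricci_scalar (vaidya_metric M) (vector [v, r, \<theta>, \<phi>]) = 2 * M2 / r + 4 * M1 r / r^2"
proof -
  define x :: "real^4" where "x = vector [v, r, \<theta>, \<phi>]"
  have x: "x$1 = v" "x$2 = r" "x$3 = \<theta>" "x$4 = \<phi>" by (simp_all add: x_def vec4)
  have xc: "x \<in> chart" using assms by (simp add: chart_def x)
  have s: "sin \<theta> > 0" using assms by (simp add: sin_gt_zero)
  have c2: "(cos \<theta>)^2 = 1 - (sin \<theta>)^2" by (simp add: cos_squared_eq)
  have inv: "matrix_inv (vaidya_metric M x) =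
     vector [vector [0, 1, 0, 0],
             vector [1, - vh M x, 0, 0],
             vector [0, 0, 1 / (x$2)^2, 0],
             vector [0, 0, 0, 1 / ((x$2)^2 * (sin (x$3))^2)]]"
    using vaidya_inv[of x M] xc by (simp add: chart_def vh_def)
  have dh: "((\<lambda>t. vh M (y + t *\<^sub>R axis 2 1)) has_real_derivative
       2 * M1 (y$2) / (y$2) - 2 * M v (y$2) / (y$2)^2) (at 0)" if "y$1 = v" "y$2 > 0" for y
  proof -
    have "((\<lambda>t. - (1 - 2 * M v (y$2 + t) / (y$2 + t))) has_real_derivative
       2 * M1 (y$2) / (y$2) - 2 * M v (y$2) / (y$2)^2) (at 0)"
    proof -
      have "((\<lambda>t. M v (y$2 + t)) has_real_derivative M1 (y$2)) (at 0)"
        using M1[OF that(2)] by (rule shift0)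
      then show ?thesis
        using that by (auto intro!: derivative_eq_intros simp: field_simps power2_eq_square)
    qed
    then show ?thesis using that by (simp add: vh_def axis4)
  qed
  have p2: "partial 2 (vh M) y = 2 * M1 (y$2) / (y$2) - 2 * M v (y$2) / (y$2)^2" 
    if "y$1 = v" "y$2 > 0" for y
    by (rule partial_eqI, rule dh, fact+)
  define P where "P = 2 * M1 r / r - 2 * M v r / r^2"
  define Q where "Q = 2 * M2 / r - 4 * M1 r / r^2 + 4 * M v r / r^3"
  have p2x: "partial 2 (vh M) x = P" using p2[of x] assms x by (simp add: P_def)
  have dp: "((\<lambda>t. partial 2 (vh M) (x + t *\<^sub>R axis 2 1)) has_real_derivative Q) (at 0)"
  proof -
    have m2: "((\<lambda>t. M1 (r + t)) has_real_derivative M2) (at 0)"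
      using M2 by (rule shift0)
    have m1: "((\<lambda>t. M v (r + t)) has_real_derivative M1 r) (at 0)"
      using M1[OF assms(1)] by (rule shift0)
    have A: "((\<lambda>t. 2 * M1 (r + t) / (r + t) - 2 * M v (r + t) / (r + t)^2) has_real_derivative Q) (at 0)"
      using m1 m2 assms(1) unfolding Q_def
      by (auto intro!: derivative_eq_intros simp: field_simps power2_eq_square power3_eq_cube)
    have ev: "eventually (\<lambda>t. partial 2 (vh M) (x + t *\<^sub>R axis 2 1)
         = 2 * M1 (r + t) / (r + t) - 2 * M v (r + t) / (r + t)^2) (nhds 0)"
    proof -
      have "eventually (\<lambda>t. t \<in> {-r<..}) (nhds 0)"
        by (rule eventually_nhds_in_open) (use assms in auto)
      then show ?thesis
        by eventually_elim (subst p2, auto simp: x axis4)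
    qed
    show ?thesis using A by (simp add: DERIV_cong_ev[OF refl ev refl])
  qed
  have pc: "partial l (christoffel (vaidya_metric M) k i j) x = partial l (\<lambda>y. vc M y k i j) x"
    for l k i j
    by (rule partial_cong_open[OF open_chart xc]) (use chr_all in blast)
  have cx: "christoffel (vaidya_metric M) k i j x = vc M x k i j" for k i j
    using chr_all[OF xc] by blast
  have h2: "((\<lambda>t. vh M (x + t *\<^sub>R axis 2 1)) has_real_derivative P) (at 0)"
    using dh[of x] assms x by (simp add: P_def)
  have q1: "partial 2 (\<lambda>y. partial 2 (vh M) y / 2) x = Q/2" "partial 2 (\<lambda>y. - partial 2 (vh M) y / 2) x = - Q/2"
    "partial 2 (\<lambda>y. - (partial 2 (vh M) y / 2)) x = - Q/2"
    by (rule partial_eqI, auto intro!: derivative_eq_intros dp)+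
  have q2: "partial 1 (\<lambda>y. 1 / y$2) x = 0" "partial 2 (\<lambda>y. 1 / y$2) x = - 1/r^2"
    "partial 3 (\<lambda>y. 1 / y$2) x = 0" "partial 4 (\<lambda>y. 1 / y$2) x = 0"
    using assms by (auto intro!: partial_eqI derivative_eq_intros simp: axis4 x power2_eq_square)
  have q3: "partial 1 (\<lambda>y. - y$2) x = 0" 
    by (auto intro!: partial_eqI derivative_eq_intros simp: axis4 x)
  have q4: "partial 2 (\<lambda>y. vh M y * y$2) x = P * r + vh M x"
    using h2 by (auto intro!: partial_eqI derivative_eq_intros simp: axis4 x)
  have q5: "partial 3 (\<lambda>y. cos (y$3) / sin (y$3)) x = - 1 / (sin \<theta>)^2" 
       "partial 4 (\<lambda>y. cos (y$3) / sin (y$3)) x = 0"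
    using s c2 by (auto intro!: partial_eqI derivative_eq_intros simp: axis4 x power2_eq_square)
  have q6: "partial 1 (\<lambda>y. - (y$2 * (sin (y$3))^2)) x = 0" 
    by (auto intro!: partial_eqI derivative_eq_intros simp: axis4 x)
  have q7: "partial 2 (\<lambda>y. vh M y * y$2 * (sin (y$3))^2) x = (P * r + vh M x) * (sin \<theta>)^2"
    using h2 by (auto intro!: partial_eqI derivative_eq_intros simp: axis4 x)
  have q8: "partial 3 (\<lambda>y. - (sin (y$3) * cos (y$3))) x = (sin \<theta>)^2 - (cos \<theta>)^2" 
    by (auto intro!: partial_eqI derivative_eq_intros simp: axis4 x power2_eq_square)
  have hx: "vh M x = 2 * M v r / r - 1" by (simp add: vh_def x)
  note S = ricci_def sum_4 pc cx vc_def Let_def x p2x q1 q2 q3 q4 q5 q6 q7 q8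
  have R12: "ricci (vaidya_metric M) 1 2 x = Q/2 + P/r"
    using assms s by (simp add: S) (simp add: field_simps power2_eq_square)?
  have R21: "ricci (vaidya_metric M) 2 1 x = Q/2 + P/r"
    using assms s by (simp add: S) (simp add: field_simps power2_eq_square)?
  have R22: "ricci (vaidya_metric M) 2 2 x = 0"
    using assms s by (simp add: S) (simp add: field_simps power2_eq_square)?
  have R33: "ricci (vaidya_metric M) 3 3 x = 1 + P * r + vh M x"
    using assms s c2 by (simp add: S) (simp add: field_simps power2_eq_square)?
  have R44: "ricci (vaidya_metric M) 4 4 x = (1 + P * r + vh M x) * (sin \<theta>)^2"
    using assms s by (simp add: S) (simp add: field_simps power2_eq_square c2[unfolded power2_eq_square])?
  have "ricci_scalar (vaidya_metric M) x = Q + 2 * P / r + 2 * (1 + P * r + vh M x) / r^2"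
    using assms s unfolding ricci_scalar_def inv sum_4 vec4 R12 R21 R22 R33 R44
    by (simp add: field_simps x)
  also have "\<dots> = 2 * M2 / r + 4 * M1 r / r^2"
    using assms unfolding P_def Q_def hx
    by (simp add: field_simps power2_eq_square power3_eq_cube)
  finally show ?thesis unfolding x_def .
qed

corollary vaidya_curvature_eq:
  assumes "r > 0"
    and "\<And>s. s > 0 \<Longrightarrow> (M v has_real_derivative M1 s) (at s)"
    and "(M1 has_real_derivative M2) (at r)"
  shows "vaidya_curvature M v r = 2 * M2 / r + 4 * M1 r / r^2"
  unfolding vaidya_curvature_def
  by (rule ricci_scalar_vaidya_metric) (use assms pi_gt_zero in auto)


subsection \<open>The linear relation and its global extension\<close>

definition smooth_on :: "real set \<Rightarrow> (real \<Rightarrow> real) \<Rightarrow> bool" where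
  "smooth_on D f \<longleftrightarrow> (\<forall>k. \<forall>x\<in>D. (deriv ^^ k) f differentiable (at x))"

text \<open>In the following, \<open>D\<close> is the domain of curvatures on which \<open>f\<close> is defined; it need not be
  all of \<open>\<real>\<close>, so \<open>deriv f\<close> may blow up at finite curvature, at a boundary point of \<open>D\<close>.
  \<open>R\<close> is the curvature as a function of $r$ at a fixed value of $v$, and \<open>a\<close>, \<open>b\<close> are the
  values of the coefficients there.\<close>

definition linear_relation ::
    "(real \<Rightarrow> real) \<Rightarrow> real set \<Rightarrow> (real \<Rightarrow> real) \<Rightarrow> real \<Rightarrow> real \<Rightarrow> real \<Rightarrow> bool" where
  "linear_relation f D R a b r \<longleftrightarrow>
     R r \<in> D \<and> deriv f (R r) = a * r + b \<and> deriv f (R r) > 0"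

definition global_extension ::
    "(real \<Rightarrow> real) \<Rightarrow> real set \<Rightarrow> (real \<Rightarrow> real) \<Rightarrow> real \<Rightarrow> real \<Rightarrow> bool" where
  "global_extension f D R a b \<longleftrightarrow>
     (\<exists>r1>0. continuous_on {r1..} R \<and> (\<forall>r\<ge>r1. linear_relation f D R a b r))"

definition inverse_branch ::
    "(real \<Rightarrow> real) \<Rightarrow> real set \<Rightarrow> (real \<Rightarrow> real) \<Rightarrow> real set \<Rightarrow> (real \<Rightarrow> real) \<Rightarrow> bool" where
  "inverse_branch f D R I \<Phi> \<longleftrightarrow>
     is_interval I \<and> I \<subseteq> D \<and> continuous_on I (deriv f) \<and> inj_on (deriv f) I \<and>
     (\<forall>x\<in>I. \<Phi> (deriv f x) = x) \<and>
     (\<forall>\<^sub>F r in at_top. R r \<in> I \<and> R r = \<Phi> (deriv f (R r)))"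

end

theory Submission
  imports Defs
begin

text \<open>For \<open>A v < 0\<close> the line $Ar+B$ eventually becomes negative, for \<open>A v > 0\<close> it tends to
  infinity and makes $R$ injective, so that $R$ takes a limit value at most once. Along a finite
  limit $R_*$, the point $R_*$ cannot lie in the branch by continuity of $f_{,R}$; hence the branch
  lies on one side of $R_*$, and by the intermediate value theorem each of its points near $R_*$ is
  some $R(r)$ with $r$ large, where $f_{,R} = Ar+B$ is large.\<close>

section \<open>Sign of the slope and growth of \<open>deriv f\<close> along the solution\<close>

lemma filterlim_affine_at_top:
  fixes a b :: real
  assumes "a > 0"
  shows "filterlim (\<lambda>r. a * r + b) at_top at_top"
  using filterlim_tendsto_add_at_top[OF tendsto_const[of b]
      filterlim_tendsto_pos_mult_at_top[OF tendsto_const assms filterlim_ident]]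
  by (simp add: add.commute)

text \<open>The positivity clause of \<open>linear_relation\<close> is what fails: a line of
  negative slope ends up at or below zero.\<close>

lemma eventually_not_linear_relation_if_neg:
  assumes "a < 0"
  shows "\<forall>\<^sub>F r in at_top. \<not> linear_relation f D R a b r"
proof -
  have "\<forall>\<^sub>F r in at_top. (- a) * r + (- b) \<ge> 0"
    using assms by (intro filterlim_at_top[THEN iffD1, rule_format] filterlim_affine_at_top) simp
  then show ?thesis
    by eventually_elim (auto simp: linear_relation_def)
qed

text \<open>Negative slope fails by positivity; with positive slope the line overtakes
  \<open>C\<close>. The bound is asked only along \<open>R\<close> for large \<open>r\<close>, so
  that bounds on a branch and bounds on the attained curvatures both reduce to it.\<close>

lemma eventually_not_linear_relation_if_bounded:
  assumes "a \<noteq> 0" and "\<forall>\<^sub>F r in at_top. deriv f (R r) \<le> C"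
  shows "\<forall>\<^sub>F r in at_top. \<not> linear_relation f D R a b r"
proof (cases "a < 0")
  case True
  then show ?thesis by (rule eventually_not_linear_relation_if_neg)
next
  case False
  then have "\<forall>\<^sub>F r in at_top. a * r + b > C"
    using filterlim_affine_at_top[of a b] assms(1) by (auto simp: filterlim_at_top_dense)
  with assms(2) show ?thesis
    by eventually_elim (auto simp: linear_relation_def)
qed

lemma global_extension_eventually:
  assumes "global_extension f D R a b"
  shows "\<forall>\<^sub>F r in at_top. linear_relation f D R a b r"
  using assms by (auto simp: global_extension_def eventually_at_top_linorder)

lemma not_global_extension:
  assumes "\<forall>\<^sub>F r in at_top. \<not> linear_relation f D R a b r"
  shows "\<not> global_extension f D R a b"
proof
  assume "global_extension f D R a b"
  from eventually_conj[OF assms global_extension_eventually[OF this]]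
  show False by (simp add: eventually_False)
qed

lemma global_extension_sign:
  assumes "global_extension f D R a b"
  shows "a = 0 \<and> b > 0 \<or> a > 0"
proof -
  have "\<not> a < 0"
    using assms not_global_extension eventually_not_linear_relation_if_neg by blast
  \<comment> \<open>With zero slope the relation at a single radius already exhibits
    \<open>b\<close> as a positive value of \<open>deriv f\<close>.\<close>
  moreover have "b > 0" if "a = 0"
    using assms that unfolding global_extension_def linear_relation_def
    by (metis add_0 mult_zero_left order_refl)
  ultimately show ?thesis by auto
qed

lemma global_extension_deriv_at_top:
  assumes "global_extension f D R a b" and "a \<noteq> 0"
  shows "filterlim (\<lambda>r. deriv f (R r)) at_top at_top"
proof -
  have "\<forall>\<^sub>F r in at_top. a * r + b = deriv f (R r)"
    using global_extension_eventually[OF assms(1)]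
    by eventually_elim (simp add: linear_relation_def)
  moreover have "filterlim (\<lambda>r. a * r + b) at_top at_top"
    using global_extension_sign[OF assms(1)] assms(2) by (auto intro: filterlim_affine_at_top)
  ultimately show ?thesis
    by (rule filterlim_cong[OF refl refl, THEN iffD1])
qed

text \<open>\<open>deriv f c\<close> is one fixed real number, also for \<open>c\<close> outside
  \<open>D\<close> since \<open>deriv\<close> is total, and the diverging
  \<open>deriv f (R r)\<close> eventually exceeds it. This lets limits of \<open>R\<close> be taken
  in punctured filters.\<close>

lemma global_extension_eventually_neq:
  assumes "global_extension f D R a b" and "a \<noteq> 0"
  shows "\<forall>\<^sub>F r in at_top. R r \<noteq> c"
proof -
  have "\<forall>\<^sub>F r in at_top. deriv f (R r) > deriv f c"
    using global_extension_deriv_at_top[OF assms] by (auto simp: filterlim_at_top_dense)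
  then show ?thesis by eventually_elim auto
qed

section \<open>Divergent curvature\<close>

text \<open>If \<open>R\<close> did not diverge, it would stay below some \<open>K\<close> at
  arbitrarily large radii; sampling there gives a sequence in \<open>I\<close> that violates
  \<open>seq\<close>.\<close>

lemma global_extension_curvature_at_top:
  assumes ext: "global_extension f D R a b" and "a \<noteq> 0"
    and I: "\<forall>\<^sub>F r in at_top. R r \<in> I"
    and seq: "\<And>s :: nat \<Rightarrow> real. (\<And>n. s n \<in> I) \<Longrightarrow>
      filterlim (\<lambda>n. deriv f (s n)) at_top sequentially \<Longrightarrow> filterlim s at_top sequentially"
  shows "filterlim R at_top at_top"
proof (rule ccontr)
  assume "\<not> filterlim R at_top at_top"
  then obtain K where K: "\<not> (\<forall>\<^sub>F r in at_top. R r \<ge> K)"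
    by (auto simp: filterlim_at_top)
  obtain r0 where r0: "\<And>r. r \<ge> r0 \<Longrightarrow> R r \<in> I"
    using I by (auto simp: eventually_at_top_linorder)
  \<comment> \<open>The bound \<open>r0\<close> keeps every sample in \<open>I\<close>, as
    \<open>seq\<close> demands for all indices; the bound \<open>n\<close> drives the radii to
    infinity.\<close>
  have "\<exists>r \<ge> max r0 (real n). R r < K" for n
    using K by (meson eventually_at_top_linorder not_le)
  then obtain t where t: "\<And>n. t n \<ge> max r0 (real n)" "\<And>n. R (t n) < K"
    by metis
  have "filterlim t at_top sequentially"
    by (rule filterlim_at_top_mono[OF filterlim_real_sequentially]) (use t(1) in auto)
  then have "filterlim (\<lambda>n. deriv f (R (t n))) at_top sequentially"
    by (rule filterlim_compose[OF global_extension_deriv_at_top[OF ext \<open>a \<noteq> 0\<close>]])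
  moreover have "R (t n) \<in> I" for n
    using r0 t(1)[of n] by simp
  ultimately have "filterlim (\<lambda>n. R (t n)) at_top sequentially"
    using seq[of "\<lambda>n. R (t n)"] by blast
  then have "\<forall>\<^sub>F n in sequentially. R (t n) \<ge> K"
    by (auto simp: filterlim_at_top)
  moreover have "\<not> R (t n) \<ge> K" for n
    using t(2)[of n] by simp
  ultimately show False by simp
qed

section \<open>Finite asymptotic curvature\<close>

lemma global_extension_tendsto_at:
  assumes "global_extension f D R a b" and "a \<noteq> 0" and "(R \<longlongrightarrow> l) at_top"
    and "\<forall>\<^sub>F r in at_top. R r \<in> S"
  shows "filterlim R (at l within S) at_top"
  using assms(3) eventually_conj[OF assms(4) global_extension_eventually_neq[OF assms(1,2), of l]]
  by (simp add: filterlim_at)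

text \<open>Intermediate value theorem on a half-line, with the limit \<open>l\<close> in the role
  of the far endpoint.\<close>

lemma tendsto_at_top_attains:
  fixes R :: "real \<Rightarrow> real"
  assumes cont: "continuous_on {r0..} R" and lim: "(R \<longlongrightarrow> l) at_top"
    and x: "R r0 \<le> x \<and> x < l \<or> l < x \<and> x \<le> R r0"
  shows "\<exists>r\<ge>r0. R r = x"
proof -
  have cont': "continuous_on {r0..r} R" for r
    by (rule continuous_on_subset[OF cont]) auto
  show ?thesis
  proof (cases "R r0 \<le> x \<and> x < l")
    case True
    \<comment> \<open>Because \<open>x < l\<close> is strict, \<open>R\<close> passes
      \<open>x\<close> at a finite radius, which serves as the second endpoint.\<close>
    then have "\<forall>\<^sub>F r in at_top. R r > x \<and> r \<ge> r0"
      using order_tendstoD(1)[OF lim] eventually_ge_at_top by (intro eventually_conj) auto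
    then obtain r where "R r > x" "r \<ge> r0"
      using eventually_happens by force
    then show ?thesis
      using IVT'[of R r0 x r] True cont' by auto
  next
    case False
    then have "\<forall>\<^sub>F r in at_top. R r < x \<and> r \<ge> r0"
      using x order_tendstoD(2)[OF lim] eventually_ge_at_top by (intro eventually_conj) auto
    then obtain r where "R r < x" "r \<ge> r0"
      using eventually_happens by force
    then show ?thesis
      using IVT2'[of R r x r0] False x cont' by auto
  qed
qed

text \<open>The first conclusion makes \<open>at l within I\<close> a proper filter, so that the
  second is not vacuous.\<close>

lemma global_extension_finite_limit:
  assumes ext: "global_extension f D R a b" and "a \<noteq> 0"
    and br: "inverse_branch f D R I \<Phi>" and lim: "(R \<longlongrightarrow> l) at_top"
  shows "l islimpt I" and "filterlim (deriv f) at_top (at l within I)"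
proof -
  have "a > 0"
    using global_extension_sign[OF ext] \<open>a \<noteq> 0\<close> by auto
  have RI: "\<forall>\<^sub>F r in at_top. R r \<in> I" and int: "is_interval I" and cont: "continuous_on I (deriv f)"
    using br by (auto simp: inverse_branch_def elim: eventually_mono)
  have at: "filterlim R (at l within I) at_top"
    by (rule global_extension_tendsto_at[OF ext \<open>a \<noteq> 0\<close> lim RI])
  \<comment> \<open>The image of the proper filter \<open>at_top\<close> under \<open>R\<close> is
    proper and lies below \<open>at l within I\<close>.\<close>
  then have "at l within I \<noteq> bot"
    by (metis bot_unique filterlim_def filtermap_bot_iff trivial_limit_at_top_linorder)
  then show "l islimpt I"
    by (simp add: trivial_limit_within)
  \<comment> \<open>Otherwise continuity would give \<open>deriv f (R r)\<close> the finite limit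
    \<open>deriv f l\<close>, although it diverges.\<close>
  have "l \<notin> I"
  proof
    assume "l \<in> I"
    then have "(deriv f \<longlongrightarrow> deriv f l) (at l within I)"
      using cont by (simp add: continuous_on_def)
    then have "((\<lambda>r. deriv f (R r)) \<longlongrightarrow> deriv f l) at_top"
      by (rule filterlim_compose[OF _ at])
    then show False
      using not_tendsto_and_filterlim_at_infinity[OF trivial_limit_at_top_linorder]
        filterlim_at_top_imp_at_infinity[OF global_extension_deriv_at_top[OF ext \<open>a \<noteq> 0\<close>]]
      by blast
  qed
  obtain r1 where r1: "continuous_on {r1..} R" "\<And>r. r \<ge> r1 \<Longrightarrow> linear_relation f D R a b r"
    using ext by (auto simp: global_extension_def)
  show "filterlim (deriv f) at_top (at l within I)"
    unfolding filterlim_at_top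
  proof
    fix K
    have "\<forall>\<^sub>F r in at_top. r \<ge> r1 \<and> R r \<in> I \<and> a * r + b \<ge> K"
      using filterlim_affine_at_top[OF \<open>a > 0\<close>, of b] RI
      by (intro eventually_conj eventually_ge_at_top) (auto simp: filterlim_at_top)
    \<comment> \<open>From \<open>r0\<close> on the line stays above \<open>K\<close>, and the
      distance from \<open>R r0\<close> to \<open>l\<close> will be the radius of the required
      neighbourhood.\<close>
    then obtain r0 where r0: "r0 \<ge> r1" "R r0 \<in> I" "a * r0 + b \<ge> K"
      using eventually_happens by force
    have "deriv f x \<ge> K" if "x \<in> I" "dist x l < dist (R r0) l" for x
    proof -
      \<comment> \<open>If \<open>x\<close> and \<open>R r0\<close> were on opposite sides of
        \<open>l\<close>, the interval \<open>I\<close> would contain \<open>l\<close>. Being closer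
        to \<open>l\<close>, \<open>x\<close> thus lies between \<open>R r0\<close> and
        \<open>l\<close>.\<close>
      have "\<not> (x \<le> l \<and> l \<le> R r0)" "\<not> (R r0 \<le> l \<and> l \<le> x)"
        using mem_is_interval_1_I[OF int] \<open>l \<notin> I\<close> that(1) r0(2) by blast+
      then have "R r0 \<le> x \<and> x < l \<or> l < x \<and> x \<le> R r0"
        using that(2) by (auto simp: dist_real_def)
      then obtain r where r: "r \<ge> r0" "R r = x"
        using tendsto_at_top_attains[OF continuous_on_subset[OF r1(1)] lim, of r0 x] r0(1) by auto
      then have "deriv f x = a * r + b"
        using r1(2)[of r] r0(1) by (auto simp: linear_relation_def)
      also have "\<dots> \<ge> a * r0 + b"
        using r \<open>a > 0\<close> by simp
      finally show ?thesis using r0(3) by simp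
    qed
    moreover have "dist (R r0) l > 0"
      using r0(2) \<open>l \<notin> I\<close> by auto
    ultimately show "\<forall>\<^sub>F x in at l within I. K \<le> deriv f x"
      unfolding eventually_at by blast
  qed
qed

section \<open>Bounded \<open>deriv f\<close>\<close>

lemma eventually_not_linear_relation_if_branch_bounded:
  assumes "a \<noteq> 0" and "inverse_branch f D R I \<Phi>"
    and "bdd_above (deriv f ` I) \<or> (\<exists>r2. bdd_above ((\<lambda>r. deriv f (R r)) ` {r2..}))"
  shows "\<forall>\<^sub>F r in at_top. \<not> linear_relation f D R a b r"
proof -
  have RI: "\<forall>\<^sub>F r in at_top. R r \<in> I"
    using assms(2) by (auto simp: inverse_branch_def elim: eventually_mono)
  from assms(3) obtain C where "\<forall>\<^sub>F r in at_top. deriv f (R r) \<le> C"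
  proof
    assume "bdd_above (deriv f ` I)"
    then obtain C where "\<And>x. x \<in> I \<Longrightarrow> deriv f x \<le> C"
      by (auto simp: bdd_above_def)
    with RI have "\<forall>\<^sub>F r in at_top. deriv f (R r) \<le> C"
      by (auto elim: eventually_mono)
    then show thesis
      by (rule that)
  next
    assume "\<exists>r2. bdd_above ((\<lambda>r. deriv f (R r)) ` {r2..})"
    then obtain r2 C where "\<And>r. r \<ge> r2 \<Longrightarrow> deriv f (R r) \<le> C"
      by (auto simp: bdd_above_def)
    then show thesis
      using that by (auto simp: eventually_at_top_linorder)
  qed
  then show ?thesis
    by (rule eventually_not_linear_relation_if_bounded[OF \<open>a \<noteq> 0\<close>])
qed

text \<open>Convergence of \<open>R\<close> to \<open>l\<close> would carry the bound near
  \<open>l\<close> over to \<open>deriv f (R r)\<close>, which diverges. The filter is taken within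
  \<open>D\<close>, where \<open>linear_relation\<close> places \<open>R r\<close>, so no branch
  enters.\<close>

lemma no_finite_limit_if_Bfun:
  assumes ext: "global_extension f D R a b" and "a \<noteq> 0"
    and bfun: "Bfun (deriv f) (at l within D)"
  shows "\<not> (R \<longlongrightarrow> l) at_top"
proof
  assume lim: "(R \<longlongrightarrow> l) at_top"
  have "\<forall>\<^sub>F r in at_top. R r \<in> D"
    using global_extension_eventually[OF ext] by eventually_elim (simp add: linear_relation_def)
  then have at: "filterlim R (at l within D) at_top"
    by (rule global_extension_tendsto_at[OF ext \<open>a \<noteq> 0\<close> lim])
  obtain C where "\<forall>\<^sub>F x in at l within D. norm (deriv f x) \<le> C"
    using bfun by (auto elim: BfunE)
  with at have "\<forall>\<^sub>F r in at_top. norm (deriv f (R r)) \<le> C"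
    unfolding filterlim_iff by blast
  moreover have "\<forall>\<^sub>F r in at_top. deriv f (R r) > C"
    using global_extension_deriv_at_top[OF ext \<open>a \<noteq> 0\<close>] by (auto simp: filterlim_at_top_dense)
  ultimately have "\<forall>\<^sub>F r :: real in at_top. False"
    by eventually_elim auto
  then show False by (simp add: eventually_False)
qed

text \<open>Boundedness on the branch and on the attained curvatures appear as a disjunction, so
  either one suffices; the failure of the relation is then stated for every large \<open>r\<close>.
  The last conjunct is outside the quantifier over branches because its boundedness condition
  concerns \<open>D\<close>.\<close>

theorem corollary1:
  fixes f :: "real \<Rightarrow> real" and D :: "real set"
    and M R :: "real \<Rightarrow> real \<Rightarrow> real" and A B :: "real \<Rightarrow> real" and v :: real
  assumes "open D" and "smooth_on D f"
    and "R = vaidya_curvature M"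
  shows
    "(global_extension f D (R v) (A v) (B v) \<longrightarrow>
        (A v = 0 \<and> B v > 0 \<or> A v > 0) \<and>
        (A v \<noteq> 0 \<longrightarrow> filterlim (\<lambda>r. deriv f (R v r)) at_top at_top)) \<and>
     (A v \<noteq> 0 \<longrightarrow>
       (\<forall>I \<Phi>. inverse_branch f D (R v) I \<Phi> \<longrightarrow>
         (bdd_above (deriv f ` I) \<or> (\<exists>r2. bdd_above ((\<lambda>r. deriv f (R v r)) ` {r2..})) \<longrightarrow>
            (\<exists>r0. \<forall>r\<ge>r0. \<not> linear_relation f D (R v) (A v) (B v) r) \<and>
            \<not> global_extension f D (R v) (A v) (B v)) \<and>
         (global_extension f D (R v) (A v) (B v) \<longrightarrow>
            (\<forall>s :: nat \<Rightarrow> real. (\<forall>n. s n \<in> I) \<longrightarrow>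
                filterlim (\<lambda>n. deriv f (s n)) at_top sequentially \<longrightarrow>
                filterlim s at_top sequentially) \<longrightarrow>
            filterlim (R v) at_top at_top) \<and>
         (global_extension f D (R v) (A v) (B v) \<longrightarrow>
            (\<forall>Rs. ((R v) \<longlongrightarrow> Rs) at_top \<longrightarrow>
                Rs islimpt I \<and> filterlim (deriv f) at_top (at Rs within I))))) \<and>
     (A v \<noteq> 0 \<longrightarrow> (\<forall>Rs. Bfun (deriv f) (at Rs within D)) \<longrightarrow>
        \<not> (global_extension f D (R v) (A v) (B v) \<and> (\<exists>Rs. ((R v) \<longlongrightarrow> Rs) at_top)))"
proof -
  have RI: "\<forall>\<^sub>F r in at_top. R v r \<in> I" if "inverse_branch f D (R v) I \<Phi>" for I \<Phi>
    using that by (auto simp: inverse_branch_def elim: eventually_mono)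
  show ?thesis
  proof (intro conjI impI allI)
    fix I \<Phi>
    assume *: "A v \<noteq> 0" "inverse_branch f D (R v) I \<Phi>"
      "bdd_above (deriv f ` I) \<or> (\<exists>r2. bdd_above ((\<lambda>r. deriv f (R v r)) ` {r2..}))"
    note ev = eventually_not_linear_relation_if_branch_bounded[OF *, of "B v"]
    show "\<exists>r0. \<forall>r\<ge>r0. \<not> linear_relation f D (R v) (A v) (B v) r"
      using ev by (simp add: eventually_at_top_linorder)
    show "\<not> global_extension f D (R v) (A v) (B v)"
      by (rule not_global_extension[OF ev])
  next
    fix I \<Phi>
    assume "A v \<noteq> 0" "inverse_branch f D (R v) I \<Phi>" "global_extension f D (R v) (A v) (B v)"
      "\<forall>s :: nat \<Rightarrow> real. (\<forall>n. s n \<in> I) \<longrightarrow>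
         filterlim (\<lambda>n. deriv f (s n)) at_top sequentially \<longrightarrow> filterlim s at_top sequentially"
    then show "filterlim (R v) at_top at_top"
      using global_extension_curvature_at_top[OF _ _ RI] by blast
  next
    assume "global_extension f D (R v) (A v) (B v)"
    then show "A v = 0 \<and> B v > 0 \<or> A v > 0"
      by (rule global_extension_sign)
  next
    assume "global_extension f D (R v) (A v) (B v)" "A v \<noteq> 0"
    then show "filterlim (\<lambda>r. deriv f (R v r)) at_top at_top"
      by (rule global_extension_deriv_at_top)
  next
    fix I \<Phi> Rs
    assume "A v \<noteq> 0" "inverse_branch f D (R v) I \<Phi>" "global_extension f D (R v) (A v) (B v)"
      "((R v) \<longlongrightarrow> Rs) at_top"
    note limit = global_extension_finite_limit[OF this(3,1,2,4)]
    show "Rs islimpt I" and "filterlim (deriv f) at_top (at Rs within I)"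
      by (fact limit)+
  next
    assume "A v \<noteq> 0" "\<forall>Rs. Bfun (deriv f) (at Rs within D)"
    then show "\<not> (global_extension f D (R v) (A v) (B v) \<and> (\<exists>Rs. ((R v) \<longlongrightarrow> Rs) at_top))"
      using no_finite_limit_if_Bfun by metis
  qed
qed

end
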